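(* Let $\mathcal{R}$ be a finite valuation ring of order $q^r$, let $d\ge2$, and let $\mathcal{E}\subseteq\mathcal{R}^d$. If $q^{r-1}\cdot q^{r(d-1)}=o(|\mathcal{E}|)$, then there exists a point $\mathbf{z}\in\mathcal{E}$ such that $|V_d^{\mathbf{z}}(\mathcal{E})|=(1-o(1))q^r$, where \[V_d^{\mathbf{z}}(\mathcal{E})=\{\det(\mathbf{x}^1-\mathbf{z},\ldots,\mathbf{x}^d-\mathbf{z})\colon \mathbf{x}^i\in\mathcal{E},\ 1\le i\le d\}.\]
   Context: $\mathcal{R}$ is a finite valuation ring: a finite commutative local ring with identity whose ideals are totally ordered by inclusion (a finite chain ring); its residue field has $q$ elements, $q$ an odd prime power, and $|\mathcal{R}|=q^r$. $\det(\mathbf{v}_1,\ldots,\mathbf{v}_d)$ is the determinant of the $d\times d$ matrix with columns $\mathbf{v}_1,\ldots,\mathbf{v}_d$. $X=o(Y)$ means $X/Y\to0$ as $q\to\infty$, and $o(1)$ denotes a quantity tending to $0$ as $q\to\infty$. *)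

theory Defs
  imports
    "HOL-Algebra.QuotRing"
    "HOL-Combinatorics.Permutations"
    "HOL-Number_Theory.Prime_Powers"
    "HOL-Library.Landau_Symbols"
begin

definition finite_valuation_ring :: "('a, 'm) ring_scheme \<Rightarrow> bool" where
  "finite_valuation_ring R \<longleftrightarrow>
     cring R \<and> finite (carrier R) \<and> (\<exists>!M. maximalideal M R) \<and>
     (\<forall>I J. ideal I R \<longrightarrow> ideal J R \<longrightarrow> I \<subseteq> J \<or> J \<subseteq> I)"

definition the_max_ideal :: "('a, 'm) ring_scheme \<Rightarrow> 'a set" where
  "the_max_ideal R = (THE M. maximalideal M R)"

definition residue_field :: "('a, 'm) ring_scheme \<Rightarrow> 'a set ring" where
  "residue_field R = R Quot the_max_ideal R"

text \<open>Vectors of \<open>R\<^sup>d\<close> are extensional functions on \<open>{..<d}\<close>, so that their number is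
  \<open>card (carrier R) ^ d\<close>.\<close>

definition vecs :: "('a, 'm) ring_scheme \<Rightarrow> nat \<Rightarrow> (nat \<Rightarrow> 'a) set" where
  "vecs R d = {..<d} \<rightarrow>\<^sub>E carrier R"

definition vec_diff ::
  "('a, 'm) ring_scheme \<Rightarrow> nat \<Rightarrow> (nat \<Rightarrow> 'a) \<Rightarrow> (nat \<Rightarrow> 'a) \<Rightarrow> nat \<Rightarrow> 'a" where
  "vec_diff R d x z = (\<lambda>k\<in>{..<d}. x k \<ominus>\<^bsub>R\<^esub> z k)"

text \<open>The Leibniz formula for the matrix whose entry in row \<open>k\<close> and column \<open>i\<close> is \<open>v i k\<close>.\<close>

definition det_cols :: "('a, 'm) ring_scheme \<Rightarrow> nat \<Rightarrow> (nat \<Rightarrow> nat \<Rightarrow> 'a) \<Rightarrow> 'a" where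
  "det_cols R d v =
     (\<Oplus>\<^bsub>R\<^esub>p\<in>{p. p permutes {..<d}}. [sign p] \<cdot>\<^bsub>R\<^esub> (\<Otimes>\<^bsub>R\<^esub>k\<in>{..<d}. v (p k) k))"

definition pinned_volumes ::
  "('a, 'm) ring_scheme \<Rightarrow> nat \<Rightarrow> (nat \<Rightarrow> 'a) set \<Rightarrow> (nat \<Rightarrow> 'a) \<Rightarrow> 'a set" where
  "pinned_volumes R d E z =
     {det_cols R d (\<lambda>i. vec_diff R d (x i) z) | x. \<forall>i<d. x i \<in> E}"

end

theory Submission
  imports Defs "HOL-Analysis.Convex"
begin

text \<open>
  Write \<open>N = |R|\<close>, let \<open>M\<close> be the maximal ideal and consider the functionals
  \<open>a\<^sub>s(y) = y\<^sub>0 + s y\<^sub>1\<close> for \<open>s \<in> R\<close>.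
  Two points \<open>y, y'\<close> of \<open>E\<close> collide under \<open>a\<^sub>s\<close> for at most one \<open>s\<close> if \<open>y\<^sub>1 - y'\<^sub>1\<close> is a unit,
  and there are at most \<open>|E| |M| N\<^bsup>d-1\<^esup>\<close> triples \<open>(s, y, y')\<close> with a collision and
  \<open>y\<^sub>1 - y'\<^sub>1 \<in> M\<close>. By averaging and the Cauchy--Schwarz inequality some \<open>s\<close> satisfies
  \<open>|a\<^sub>s(E)| \<ge> N |E| / (|E| + |M| N\<^bsup>d-1\<^esup>)\<close>.

  A most popular hyperplane \<open>a\<^sub>s = t\<close> contains at least \<open>|E| / N > |M| N\<^bsup>d-2\<^esup>\<close> points of \<open>E\<close>,
  too many for their reductions modulo \<open>M\<close> to lie in a proper affine subspace of the hyperplane.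
  Hence there are points \<open>z, x\<^sup>1, \<dots>, x\<^bsup>d-1\<^esup>\<close> of \<open>E\<close> on it such that
  \<open>det(y - z, x\<^sup>1 - z, \<dots>, x\<^bsup>d-1\<^esup> - z)\<close> is a fixed unit times \<open>a\<^sub>s(y) - t\<close> for every \<open>y\<close>,
  so the volumes pinned at \<open>z\<close> are at least as many as the values of \<open>a\<^sub>s\<close> on \<open>E\<close>.
\<close>

section \<open>Determinants over a commutative ring\<close>

lemma permutes_less:
  assumes "p permutes {..<d :: nat}" "k < d"
  shows "p k < d" "inv_into UNIV p k < d"
  using permutes_in_image[OF assms(1)] permutes_in_image[OF permutes_inv[OF assms(1)]] assms(2)
  by auto

context cring
begin

lemma det_term_closed:
  assumes "p permutes {..<d :: nat}" "\<And>i k. i < d \<Longrightarrow> k < d \<Longrightarrow> v i k \<in> carrier R"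
  shows "(\<Otimes>k\<in>{..<d}. v (p k) k) \<in> carrier R"
  using assms by (intro finprod_closed) (auto simp: permutes_less(1)[OF assms(1)])

lemma det_cols_closed:
  assumes "\<And>i k. i < d \<Longrightarrow> k < d \<Longrightarrow> v i k \<in> carrier R"
  shows "det_cols R d v \<in> carrier R"
  unfolding det_cols_def using assms
  by (intro finsum_closed) (auto intro!: add.int_pow_closed det_term_closed)

lemma det_cols_cong:
  assumes "\<And>i k. i < d \<Longrightarrow> k < d \<Longrightarrow> v i k = w i k"
    and "\<And>i k. i < d \<Longrightarrow> k < d \<Longrightarrow> w i k \<in> carrier R"
  shows "det_cols R d v = det_cols R d w"
proof -
  have "(\<Otimes>k\<in>{..<d}. v (p k) k) = (\<Otimes>k\<in>{..<d}. w (p k) k)" if "p permutes {..<d}" for p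
    using that assms by (intro finprod_cong') (auto simp: permutes_less(1)[OF that])
  then show ?thesis
    unfolding det_cols_def using assms(2)
    by (intro finsum_cong') (auto intro!: add.int_pow_closed det_term_closed)
qed

text \<open>The Leibniz term of \<open>p\<close> meets column \<open>i\<close> exactly once, in row
  \<open>inv_into UNIV p i\<close>; all its other factors and the sign go into \<open>c p\<close>.
  Since \<open>c\<close> is chosen before \<open>w\<close>, linearity in column \<open>i\<close>
  follows. Indexing coefficients by permutations instead of rows avoids grouping terms into
  cofactors.\<close>

lemma det_cols_column_expansion:
  assumes "i < d" and v: "\<And>j k. j < d \<Longrightarrow> k < d \<Longrightarrow> v j k \<in> carrier R"
  shows "\<exists>c \<in> {p. p permutes {..<d}} \<rightarrow> carrier R. \<forall>w \<in> {..<d} \<rightarrow> carrier R.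
    det_cols R d (v(i := w)) =
      (\<Oplus>p\<in>{p. p permutes {..<d}}. w (inv_into UNIV p i) \<otimes> c p)"
proof (intro bexI ballI)
  let ?c = "\<lambda>p. [sign p] \<cdot> (\<Otimes>k\<in>{..<d} - {inv_into UNIV p i}. v (p k) k)"
  have P: "(\<Otimes>k\<in>{..<d} - {inv_into UNIV p i}. v (p k) k) \<in> carrier R"
    if "p permutes {..<d}" for p
    using that v by (intro finprod_closed) (auto simp: permutes_less(1)[OF that])
  have c: "?c p \<in> carrier R" if "p permutes {..<d}" for p
    using P[OF that] by (rule add.int_pow_closed)
  then show "?c \<in> {p. p permutes {..<d}} \<rightarrow> carrier R" by blast
  fix w assume "w \<in> {..<d} \<rightarrow> carrier R"
  then have w: "\<And>k. k < d \<Longrightarrow> w k \<in> carrier R" by blast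
  have "[sign p] \<cdot> (\<Otimes>k\<in>{..<d}. (v(i := w)) (p k) k) = w (inv_into UNIV p i) \<otimes> ?c p"
    if p: "p permutes {..<d}" for p
  proof -
    let ?k = "inv_into UNIV p i"
    have k: "?k < d" using p \<open>i < d\<close> by (rule permutes_less)
    have pk: "p ?k = i" using p by (simp add: permutes_inverses)
    have ne: "p j \<noteq> i" if "j \<noteq> ?k" for j using that p by (metis permutes_inverses(2))
    have "(\<Otimes>k\<in>{..<d}. (v(i := w)) (p k) k) =
        (\<Otimes>k\<in>insert ?k ({..<d} - {?k}). (v(i := w)) (p k) k)"
      using k by (simp add: insert_absorb)
    also have "\<dots> = w ?k \<otimes> (\<Otimes>k\<in>{..<d} - {?k}. (v(i := w)) (p k) k)"
      using k pk v w by (subst finprod_insert) (auto simp: permutes_less(1)[OF p])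
    also have "(\<Otimes>k\<in>{..<d} - {?k}. (v(i := w)) (p k) k) = (\<Otimes>k\<in>{..<d} - {?k}. v (p k) k)"
      using v ne by (intro finprod_cong') (auto simp: permutes_less(1)[OF p])
    finally show ?thesis using add_pow_rdistr_int[OF w[OF k] P[OF p]] by simp
  qed
  moreover have "inv_into UNIV p i < d" if "p permutes {..<d}" for p
    using that \<open>i < d\<close> by (rule permutes_less)
  ultimately show "det_cols R d (v(i := w)) =
        (\<Oplus>p\<in>{p. p permutes {..<d}}. w (inv_into UNIV p i) \<otimes> ?c p)"
    unfolding det_cols_def using c w by (intro finsum_cong') auto
qed

lemma det_cols_add:
  assumes "i < d" "\<And>j k. j < d \<Longrightarrow> k < d \<Longrightarrow> v j k \<in> carrier R"
    and x: "\<And>k. k < d \<Longrightarrow> x k \<in> carrier R" and y: "\<And>k. k < d \<Longrightarrow> y k \<in> carrier R"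
  shows "det_cols R d (v(i := \<lambda>k. x k \<oplus> y k)) =
    det_cols R d (v(i := x)) \<oplus> det_cols R d (v(i := y))"
proof -
  have "\<exists>c \<in> {p. p permutes {..<d}} \<rightarrow> carrier R. \<forall>w \<in> {..<d} \<rightarrow> carrier R.
    det_cols R d (v(i := w)) = (\<Oplus>p\<in>{p. p permutes {..<d}}. w (inv_into UNIV p i) \<otimes> c p)"
    by (rule det_cols_column_expansion) (use assms(1,2) in auto)
  then obtain c where c: "\<And>p. p permutes {..<d} \<Longrightarrow> c p \<in> carrier R"
    and D: "\<And>w. (\<And>k. k < d \<Longrightarrow> w k \<in> carrier R) \<Longrightarrow> det_cols R d (v(i := w)) =
        (\<Oplus>p\<in>{p. p permutes {..<d}}. w (inv_into UNIV p i) \<otimes> c p)"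
    by (auto simp: Pi_def)
  have I: "inv_into UNIV p i < d" if "p permutes {..<d}" for p
    using that \<open>i < d\<close> by (rule permutes_less)
  have "det_cols R d (v(i := \<lambda>k. x k \<oplus> y k)) = (\<Oplus>p\<in>{p. p permutes {..<d}}.
      x (inv_into UNIV p i) \<otimes> c p \<oplus> y (inv_into UNIV p i) \<otimes> c p)"
    using c I x y by (subst D, simp) (intro finsum_cong', auto simp: l_distr)
  also have "\<dots> = det_cols R d (v(i := x)) \<oplus> det_cols R d (v(i := y))"
    using c I x y by (subst (1 2) D) auto
  finally show ?thesis .
qed

lemma det_cols_smult:
  assumes "i < d" "\<And>j k. j < d \<Longrightarrow> k < d \<Longrightarrow> v j k \<in> carrier R"
    and x: "\<And>k. k < d \<Longrightarrow> x k \<in> carrier R" and a: "a \<in> carrier R"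
  shows "det_cols R d (v(i := \<lambda>k. a \<otimes> x k)) = a \<otimes> det_cols R d (v(i := x))"
proof -
  have "\<exists>c \<in> {p. p permutes {..<d}} \<rightarrow> carrier R. \<forall>w \<in> {..<d} \<rightarrow> carrier R.
    det_cols R d (v(i := w)) = (\<Oplus>p\<in>{p. p permutes {..<d}}. w (inv_into UNIV p i) \<otimes> c p)"
    by (rule det_cols_column_expansion) (use assms(1,2) in auto)
  then obtain c where c: "\<And>p. p permutes {..<d} \<Longrightarrow> c p \<in> carrier R"
    and D: "\<And>w. (\<And>k. k < d \<Longrightarrow> w k \<in> carrier R) \<Longrightarrow> det_cols R d (v(i := w)) =
        (\<Oplus>p\<in>{p. p permutes {..<d}}. w (inv_into UNIV p i) \<otimes> c p)"
    by (auto simp: Pi_def)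
  have I: "inv_into UNIV p i < d" if "p permutes {..<d}" for p
    using that \<open>i < d\<close> by (rule permutes_less)
  have "det_cols R d (v(i := \<lambda>k. a \<otimes> x k)) =
      (\<Oplus>p\<in>{p. p permutes {..<d}}. a \<otimes> (x (inv_into UNIV p i) \<otimes> c p))"
    using c I x a by (subst D, simp) (intro finsum_cong', auto simp: m_assoc)
  also have "\<dots> = a \<otimes> det_cols R d (v(i := x))"
    using c I x a
    by (subst D, simp) (intro finsum_rdistr[symmetric], auto simp: finite_permutations)
  finally show ?thesis .
qed

text \<open>By proportionality, rows \<open>k\<close> and \<open>l\<close> contribute
  \<open>s\<close> times a product symmetric in \<open>p k\<close> and \<open>p l\<close>. Hence
  \<open>p\<close> and \<open>p \<circ> ?t\<close> have equal products and opposite signs, and the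
  terms cancel in pairs. The pairing argument works in every characteristic, including 2.\<close>

lemma det_cols_eq_zero_if_proportional_rows:
  assumes "k < d" "l < d" "k \<noteq> l"
    and v: "\<And>i j. i < d \<Longrightarrow> j < d \<Longrightarrow> v i j \<in> carrier R"
    and s: "s \<in> carrier R" "\<And>i. i < d \<Longrightarrow> v i k = s \<otimes> v i l"
  shows "det_cols R d v = \<zero>"
proof -
  let ?t = "transpose k l"
  let ?f = "\<lambda>p. [sign p] \<cdot> (\<Otimes>j\<in>{..<d}. v (p j) j)"
  let ?E = "{p. p permutes {..<d} \<and> evenperm p}"
  let ?O = "{p. p permutes {..<d} \<and> \<not> evenperm p}"
  have t: "?t permutes {..<d}" using assms by (intro permutes_swap_id) auto
  have perm: "permutation p" if "p permutes {..<d}" for p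
    using that by (auto simp: permutation_permutes)
  have te: "\<not> evenperm ?t" using \<open>k \<noteq> l\<close> by (simp add: evenperm_swap)
  have fc: "?f p \<in> carrier R" if "p permutes {..<d}" for p
    using that v by (intro add.int_pow_closed det_term_closed)
  have pt: "p \<circ> ?t permutes {..<d}" if "p permutes {..<d}" for p
    using permutes_compose[OF t that] .
  have ev: "evenperm (p \<circ> ?t) \<longleftrightarrow> \<not> evenperm p" if "p permutes {..<d}" for p
    using evenperm_comp[OF perm[OF that] perm[OF t]] te by auto
  have fin: "finite ?E" "finite ?O"
    using finite_permutations[of "{..<d}"] by (auto intro: finite_subset[rotated])
  have split: "(\<Otimes>j\<in>{..<d}. v (p j) j) =
      s \<otimes> (v (p k) l \<otimes> v (p l) l) \<otimes> (\<Otimes>j\<in>{..<d} - {k, l}. v (p j) j)"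
    if p: "p permutes {..<d}" for p
  proof -
    have [simp]: "p j < d" if "j < d" for j using p that by (rule permutes_less)
    have "{..<d} = insert k (insert l ({..<d} - {k, l}))" using assms by auto
    then have "(\<Otimes>j\<in>{..<d}. v (p j) j) =
        (\<Otimes>j\<in>insert k (insert l ({..<d} - {k, l})). v (p j) j)" by simp
    also have "\<dots> = v (p k) k \<otimes> (v (p l) l \<otimes> (\<Otimes>j\<in>{..<d} - {k, l}. v (p j) j))"
      using assms by (subst finprod_insert, auto)
    also have "(\<Otimes>j\<in>{..<d} - {k, l}. v (p j) j) \<in> carrier R"
      using v by (intro finprod_closed) auto
    ultimately show ?thesis using assms by (simp add: m_assoc)
  qed
  have same: "(\<Otimes>j\<in>{..<d}. v ((p \<circ> ?t) j) j) = (\<Otimes>j\<in>{..<d}. v (p j) j)"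
    if p: "p permutes {..<d}" for p
  proof -
    have [simp]: "p j < d" if "j < d" for j using p that by (rule permutes_less)
    have "(\<Otimes>j\<in>{..<d} - {k, l}. v ((p \<circ> ?t) j) j) = (\<Otimes>j\<in>{..<d} - {k, l}. v (p j) j)"
      using v by (intro finprod_cong') (auto simp: transpose_def)
    then show ?thesis
      unfolding split[OF p] split[OF pt[OF p]] using assms by (simp add: m_comm)
  qed
  have neg: "?f (p \<circ> ?t) = \<ominus> ?f p" if "p permutes {..<d}" "evenperm p" for p
  proof -
    have c: "(\<Otimes>j\<in>{..<d}. v (p j) j) \<in> carrier R"
      using that v by (intro det_term_closed)
    have "sign p = 1" "sign (p \<circ> ?t) = - 1" using that ev by (auto simp: sign_def)
    then show ?thesis unfolding same[OF that(1)] using c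
      by (simp add: add_pow_int_lt add_pow_int_ge)
  qed
  have img: "?O = (\<lambda>p. p \<circ> ?t) ` ?E"
  proof (intro subset_antisym subsetI)
    fix p assume "p \<in> ?O"
    then have "p \<circ> ?t \<in> ?E" using ev pt by auto
    moreover have "p = (p \<circ> ?t) \<circ> ?t" by (simp add: comp_assoc)
    ultimately show "p \<in> (\<lambda>p. p \<circ> ?t) ` ?E" by blast
  qed (use ev pt in auto)
  have inj: "inj_on (\<lambda>p. p \<circ> ?t) ?E"
    by (rule inj_on_inverseI[where g = "\<lambda>p. p \<circ> ?t"]) (simp add: comp_assoc)
  have "det_cols R d v = (\<Oplus>p\<in>?E \<union> ?O. ?f p)"
    unfolding det_cols_def by (rule arg_cong[where f = "finsum R _"]) auto
  also have "\<dots> = (\<Oplus>p\<in>?E. ?f p) \<oplus> (\<Oplus>p\<in>?O. ?f p)"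
    using fin fc by (intro finsum_Un_disjoint) auto
  also have "(\<Oplus>p\<in>?O. ?f p) = (\<Oplus>p\<in>?E. ?f (p \<circ> ?t))"
    unfolding img using inj fc pt by (intro finsum_reindex) auto
  also have "\<dots> = (\<Oplus>p\<in>?E. \<ominus> ?f p)"
    using fc neg by (intro finsum_cong') auto
  also have "(\<Oplus>p\<in>?E. ?f p) \<oplus> (\<Oplus>p\<in>?E. \<ominus> ?f p) = (\<Oplus>p\<in>?E. ?f p \<oplus> \<ominus> ?f p)"
    using fc by (intro finsum_addf[symmetric]) auto
  also have "\<dots> = \<zero>"
    using fc by (intro add.finprod_one_eqI) (auto simp: r_neg)
  finally show ?thesis .
qed

text \<open>A permutation of \<open>{..<d}\<close> with \<open>p k \<ge> k\<close> for all
  \<open>k\<close> is the identity. Every other one has some \<open>p k < k\<close>, so its product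
  contains a zero entry.\<close>

lemma det_cols_unitriangular:
  assumes v: "\<And>i k. i < d \<Longrightarrow> k < d \<Longrightarrow> v i k \<in> carrier R"
    and diag: "\<And>i. i < d \<Longrightarrow> v i i = \<one>"
    and upper: "\<And>i k. i < d \<Longrightarrow> k < d \<Longrightarrow> i < k \<Longrightarrow> v i k = \<zero>"
  shows "det_cols R d v = \<one>"
proof -
  let ?f = "\<lambda>p. [sign p] \<cdot> (\<Otimes>j\<in>{..<d}. v (p j) j)"
  have zero: "?f p = \<zero>" if p: "p permutes {..<d}" and "p \<noteq> id" for p
  proof -
    obtain k where k: "k < d" "p k < k"
      using permutes_natset_ge[OF p] \<open>p \<noteq> id\<close> by (metis lessThan_iff not_less)
    have "p k < d" using k by simp
    have "(\<Otimes>j\<in>{..<d}. v (p j) j) = (\<Otimes>j\<in>insert k ({..<d} - {k}). v (p j) j)"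
      using k by (simp add: insert_absorb)
    also have "\<dots> = \<zero> \<otimes> (\<Otimes>j\<in>{..<d} - {k}. v (p j) j)"
      using k v upper[OF \<open>p k < d\<close> k] by (subst finprod_insert) (auto simp: permutes_less(1)[OF p])
    also have "\<dots> = \<zero>"
      using v by (intro l_null finprod_closed) (auto simp: permutes_less(1)[OF p])
    finally show ?thesis by simp
  qed
  have "det_cols R d v = (\<Oplus>p\<in>{p. p permutes {..<d}}. if id = p then ?f p else \<zero>)"
    unfolding det_cols_def using zero v
    by (intro finsum_cong') (auto intro!: add.int_pow_closed det_term_closed)
  also have "\<dots> = ?f id"
    using v by (intro finsum_singleton)
      (auto simp: permutes_id finite_permutations intro!: add.int_pow_closed det_term_closed)
  also have "(\<Otimes>j\<in>{..<d}. v (id j) j) = \<one>"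
    using diag by (intro finprod_one_eqI) auto
  finally show ?thesis by (simp add: add_pow_int_ge)
qed

end

section \<open>Collisions of linear functionals\<close>

text \<open>Colliding pairs are counted by the sum of the squared fibre sizes, while the fibre sizes
  themselves sum to \<open>card E\<close>; Cauchy-Schwarz over the values of \<open>f\<close>
  compares the two.\<close>

lemma card_square_le_image_times_collisions:
  assumes "finite E"
  shows "(card E)\<^sup>2 \<le> card (f ` E) * card {(y, y'). y \<in> E \<and> y' \<in> E \<and> f y = f y'}"
proof -
  let ?F = "\<lambda>t. {y \<in> E. f y = t}"
  have fin: "finite (?F t)" for t using assms by auto
  have "{(y, y'). y \<in> E \<and> y' \<in> E \<and> f y = f y'} = (\<Union>t\<in>f ` E. ?F t \<times> ?F t)" by auto
  also have "card \<dots> = (\<Sum>t\<in>f ` E. card (?F t \<times> ?F t))"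
    using assms by (intro card_UN_disjoint) auto
  finally have coll: "card {(y, y'). y \<in> E \<and> y' \<in> E \<and> f y = f y'} = (\<Sum>t\<in>f ` E. (card (?F t))\<^sup>2)"
    by (simp add: card_cartesian_product power2_eq_square)
  have "card E = card (\<Union>t\<in>f ` E. ?F t)" by (rule arg_cong[where f = card]) auto
  also have "\<dots> = (\<Sum>t\<in>f ` E. card (?F t))"
    using assms by (intro card_UN_disjoint) auto
  finally have "real (card E) = (\<Sum>t\<in>f ` E. real (card (?F t)))" by simp
  then have "(real (card E))\<^sup>2 \<le> real (card (f ` E)) * (\<Sum>t\<in>f ` E. (real (card (?F t)))\<^sup>2)"
    using sum_squared_le_sum_of_squares[of "\<lambda>t. real (card (?F t))" "f ` E"] assms
    by (simp add: mult.commute)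
  also have "\<dots> = real (card (f ` E) * card {(y, y'). y \<in> E \<and> y' \<in> E \<and> f y = f y'})"
    unfolding coll by simp
  finally show ?thesis by (simp only: of_nat_le_iff flip: of_nat_power)
qed

lemma exists_le_average:
  fixes f :: "'b \<Rightarrow> nat"
  assumes "finite A" "A \<noteq> {}" "sum f A \<le> B"
  shows "\<exists>a\<in>A. card A * f a \<le> B"
proof (rule ccontr)
  assume "\<not> ?thesis"
  then have "(\<Sum>a\<in>A. B) < (\<Sum>a\<in>A. card A * f a)"
    using assms by (intro sum_strict_mono) auto
  also have "\<dots> = card A * sum f A" by (simp add: sum_distrib_left)
  finally show False using assms(3) by simp
qed

lemma exists_large_fibre:
  assumes "finite E" "finite T" "T \<noteq> {}" "f ` E \<subseteq> T"
  shows "\<exists>t\<in>T. card E \<le> card T * card {y \<in> E. f y = t}"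
proof (rule ccontr)
  assume "\<not> ?thesis"
  then have "(\<Sum>t\<in>T. card T * card {y \<in> E. f y = t}) < (\<Sum>t\<in>T. card E)"
    using assms by (intro sum_strict_mono) auto
  moreover have "(\<Sum>t\<in>T. card {y \<in> E. f y = t}) = card (\<Union>t\<in>T. {y \<in> E. f y = t})"
    using assms by (intro card_UN_disjoint[symmetric]) auto
  moreover have "(\<Union>t\<in>T. {y \<in> E. f y = t}) = E" using assms by auto
  ultimately show False by (simp flip: sum_distrib_left)
qed

context cring
begin

section \<open>Counting collisions over all slopes\<close>

lemma finite_vecs: "finite (carrier R) \<Longrightarrow> finite (vecs R d)"
  unfolding vecs_def by (intro finite_PiE) auto

lemma vecs_closed: "x \<in> vecs R d \<Longrightarrow> k < d \<Longrightarrow> x k \<in> carrier R"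
  unfolding vecs_def by auto

lemma vecs_eqI:
  assumes "x \<in> vecs R d" "y \<in> vecs R d" "\<And>k. k < d \<Longrightarrow> x k = y k"
  shows "x = y"
  using assms unfolding vecs_def by (auto intro: PiE_ext)

text \<open>Subtracting the term \<open>a \<oplus> s \<otimes> b'\<close> from both sides isolates
  the slope. When \<open>b \<ominus> b'\<close> is a unit, a collision therefore determines
  \<open>s\<close>.\<close>

lemma slope_times_diff:
  assumes [simp]: "s \<in> carrier R" "a \<in> carrier R" "b \<in> carrier R" "a' \<in> carrier R" "b' \<in> carrier R"
    and eq: "a \<oplus> s \<otimes> b = a' \<oplus> s \<otimes> b'"
  shows "s \<otimes> (b \<ominus> b') = a' \<ominus> a"
proof -
  have "s \<otimes> (b \<ominus> b') = (a \<oplus> s \<otimes> b) \<ominus> (a \<oplus> s \<otimes> b')"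
    using assms(1-5) by algebra
  also have "\<dots> = a' \<ominus> a" unfolding eq using assms(1-5) by algebra
  finally show ?thesis .
qed

lemma diff_left_cancel:
  assumes "a \<in> carrier R" "b \<in> carrier R" "c \<in> carrier R" "a \<ominus> b = a \<ominus> c"
  shows "b = c"
proof -
  have "\<ominus> b = \<ominus> c" using assms by (simp add: minus_eq)
  then show ?thesis using assms by (metis minus_minus)
qed

lemma card_collisions_le:
  assumes fin: "finite (carrier R)" and d: "2 \<le> d" and E: "E \<subseteq> vecs R d"
    and M: "M \<subseteq> carrier R" and nonunits: "carrier R - Units R \<subseteq> M"
  shows "card {(s, y, y'). s \<in> carrier R \<and> y \<in> E \<and> y' \<in> E \<and>
      y 0 \<oplus> s \<otimes> y 1 = y' 0 \<oplus> s \<otimes> y' 1}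
    \<le> card E * (card E + card M * card (carrier R) ^ (d - 1))" (is "card ?T \<le> _")
proof -
  let ?U = "{(s, y, y'). (s, y, y') \<in> ?T \<and> y 1 \<ominus> y' 1 \<in> Units R}"
  let ?N = "{(s, y, y'). (s, y, y') \<in> ?T \<and> y 1 \<ominus> y' 1 \<in> M}"
  have finE: "finite E" using finite_subset[OF E finite_vecs[OF fin]] .
  have finM: "finite M" using finite_subset[OF M fin] .
  have finT: "finite ?T"
    by (rule finite_subset[of _ "carrier R \<times> E \<times> E"]) (use fin finE in auto)
  have cl: "y k \<in> carrier R" if "y \<in> E" "k < d" for y k using that E vecs_closed by blast
  have d01: "0 < d" "1 < d" using d by auto
  have "y 1 \<ominus> y' 1 \<in> Units R \<or> y 1 \<ominus> y' 1 \<in> M" if "y \<in> E" "y' \<in> E" for y y'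
    using cl[OF that(1) d01(2)] cl[OF that(2) d01(2)] nonunits by blast
  then have cover: "?T \<subseteq> ?U \<union> ?N" by auto
  \<comment> \<open>\<open>s\<close> is determined by \<open>y\<close> and \<open>y'\<close> in \<open>?U\<close>; in \<open>?N\<close>, it is \<open>y' 0\<close> that is redundant.\<close>
  have "card ?U \<le> card (E \<times> E)"
  proof (rule card_inj_on_le[where f = snd])
    show "inj_on snd ?U"
    proof (rule inj_onI)
      fix p p' assume *: "p \<in> ?U" "p' \<in> ?U" "snd p = snd p'"
      obtain s y y' where p: "p = (s, y, y')" by (cases p)
      obtain s' where p': "p' = (s', y, y')" using * p by (cases p') auto
      have h: "s \<in> carrier R" "s' \<in> carrier R" "y \<in> E" "y' \<in> E"
        "y 0 \<oplus> s \<otimes> y 1 = y' 0 \<oplus> s \<otimes> y' 1"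
        "y 0 \<oplus> s' \<otimes> y 1 = y' 0 \<oplus> s' \<otimes> y' 1"
        "y 1 \<ominus> y' 1 \<in> Units R"
        using * unfolding p p' by auto
      have c: "y 0 \<in> carrier R" "y 1 \<in> carrier R" "y' 0 \<in> carrier R" "y' 1 \<in> carrier R"
        using h cl d01 by auto
      have "s \<otimes> (y 1 \<ominus> y' 1) = s' \<otimes> (y 1 \<ominus> y' 1)"
        using slope_times_diff[OF h(1) c h(5)] slope_times_diff[OF h(2) c] h(6) by simp
      then have "(y 1 \<ominus> y' 1) \<otimes> s = (y 1 \<ominus> y' 1) \<otimes> s'"
        using c h(1,2) by (simp add: m_comm)
      then have "s = s'" using h(1,2,7) by (simp only: Units_l_cancel)
      then show "p = p'" unfolding p p' by simp
    qed
  qed (use finE in auto)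
  also have "\<dots> = card E * card E" by (simp add: card_cartesian_product)
  finally have U: "card ?U \<le> card E * card E" .
  let ?P = "{1..<d} \<rightarrow>\<^sub>E carrier R"
  \<comment> \<open>Slot 1 of the tuple is free to hold \<open>s\<close>, because
    \<open>y' 1\<close> is recovered from \<open>y 1 \<ominus> y' 1\<close>; slots 2 to
    \<open>d - 1\<close> hold the coordinates of \<open>y'\<close>. The missing \<open>y' 0\<close>
    then follows from the collision equation.\<close>
  let ?g = "\<lambda>(s, y, y'). (y, y 1 \<ominus> y' 1, \<lambda>k\<in>{1..<d}. if k = 1 then s else y' k)"
  have "card ?N \<le> card (E \<times> M \<times> ?P)"
  proof (rule card_inj_on_le[where f = ?g])
    show "inj_on ?g ?N"
    proof (rule inj_onI)
      fix p p' assume *: "p \<in> ?N" "p' \<in> ?N" "?g p = ?g p'"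
      obtain s y y' where p: "p = (s, y, y')" by (cases p)
      obtain s' b where p': "p' = (s', y, b)" using *(3) p
        by (cases p') (simp only: case_prod_conv prod.inject)
      have h: "s \<in> carrier R" "s' \<in> carrier R" "y \<in> E" "y' \<in> E" "b \<in> E"
        "y 0 \<oplus> s \<otimes> y 1 = y' 0 \<oplus> s \<otimes> y' 1"
        "y 0 \<oplus> s' \<otimes> y 1 = b 0 \<oplus> s' \<otimes> b 1"
        "y 1 \<ominus> y' 1 = y 1 \<ominus> b 1"
        and r: "(\<lambda>k\<in>{1..<d}. if k = 1 then s else y' k) =
          (\<lambda>k\<in>{1..<d}. if k = 1 then s' else b k)"
        using * unfolding p p' by (simp_all only: mem_Collect_eq case_prod_conv prod.inject)
      have c: "y 0 \<in> carrier R" "y 1 \<in> carrier R" "y' 0 \<in> carrier R"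
        "y' 1 \<in> carrier R" "b 0 \<in> carrier R" "b 1 \<in> carrier R"
        using h cl d01 by auto
      have s: "s = s'" using fun_cong[OF r, of 1] d by simp
      have one: "y' 1 = b 1" by (rule diff_left_cancel[OF c(2,4,6) h(8)])
      have "y' 0 \<oplus> s \<otimes> b 1 = b 0 \<oplus> s \<otimes> b 1" using h(6,7) unfolding s one by simp
      then have zero: "y' 0 = b 0" using c h(1) by simp
      have "y' k = b k" if "k < d" for k
      proof (cases "k = 0 \<or> k = 1")
        case False
        then show ?thesis using fun_cong[OF r, of k] that by simp
      qed (use zero one in auto)
      then have "y' = b" using h E by (intro vecs_eqI[of _ d]) auto
      then show "p = p'" unfolding p p' using s by simp
    qed
    show "?g ` ?N \<subseteq> E \<times> M \<times> ?P" using cl by (auto simp: PiE_def)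
    show "finite (E \<times> M \<times> ?P)" using finE finM fin by (auto intro: finite_PiE)
  qed
  also have "\<dots> = card E * (card M * card (carrier R) ^ (d - 1))"
    by (simp add: card_cartesian_product card_PiE)
  finally have N: "card ?N \<le> card E * (card M * card (carrier R) ^ (d - 1))" .
  have "card ?T \<le> card (?U \<union> ?N)"
    using cover by (intro card_mono) (auto intro: finite_subset[OF _ finT])
  also have "\<dots> \<le> card ?U + card ?N" by (rule card_Un_le)
  finally show ?thesis using U N by (simp add: distrib_left)
qed

lemma exists_equidistributing_slope:
  assumes fin: "finite (carrier R)" and d: "2 \<le> d" and E: "E \<subseteq> vecs R d" "E \<noteq> {}"
    and M: "M \<subseteq> carrier R" and nonunits: "carrier R - Units R \<subseteq> M"
  shows "\<exists>s\<in>carrier R. card (carrier R) * card E \<le>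
    card ((\<lambda>y. y 0 \<oplus> s \<otimes> y 1) ` E) * (card E + card M * card (carrier R) ^ (d - 1))"
proof -
  let ?C = "\<lambda>s. {(y, y'). y \<in> E \<and> y' \<in> E \<and> y 0 \<oplus> s \<otimes> y 1 = y' 0 \<oplus> s \<otimes> y' 1}"
  let ?B = "card E + card M * card (carrier R) ^ (d - 1)"
  let ?N = "card (carrier R)"
  have finE: "finite E" using finite_subset[OF E(1) finite_vecs[OF fin]] .
  have "finite (?C s)" for s
    by (rule finite_subset[of _ "E \<times> E"]) (use finE in auto)
  then have "(\<Sum>s\<in>carrier R. card (?C s)) = card (SIGMA s:carrier R. ?C s)"
    using fin by (intro card_SigmaI[symmetric]) auto
  also have "(SIGMA s:carrier R. ?C s) = {(s, y, y'). s \<in> carrier R \<and> y \<in> E \<and> y' \<in> E \<and>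
      y 0 \<oplus> s \<otimes> y 1 = y' 0 \<oplus> s \<otimes> y' 1}" by auto
  also have "card \<dots> \<le> card E * ?B"
    using card_collisions_le[OF fin d E(1) M nonunits] .
  finally have "(\<Sum>s\<in>carrier R. card (?C s)) \<le> card E * ?B" .
  then obtain s where s: "s \<in> carrier R" "?N * card (?C s) \<le> card E * ?B"
    using exists_le_average[OF fin] zero_closed by blast
  let ?I = "card ((\<lambda>y. y 0 \<oplus> s \<otimes> y 1) ` E)"
  \<comment> \<open>Cauchy-Schwarz bounds the collisions of \<open>s\<close> from below and the
    average bounds them from above; one factor \<open>card E\<close>, nonzero by assumption, is
    cancelled at the end.\<close>
  have "card E * (?N * card E) = ?N * (card E)\<^sup>2" by (simp add: power2_eq_square)
  also have "\<dots> \<le> ?N * (?I * card (?C s))"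
    using card_square_le_image_times_collisions[OF finE] by (intro mult_left_mono) auto
  also have "\<dots> = ?I * (?N * card (?C s))" by simp
  also have "\<dots> \<le> ?I * (card E * ?B)" using s(2) by (intro mult_left_mono) auto
  also have "\<dots> = card E * (?I * ?B)" by simp
  finally have "?N * card E \<le> ?I * ?B" using E(2) finE by (simp add: card_gt_0_iff)
  then show ?thesis using s(1) by blast
qed

end

section \<open>Pinned volumes\<close>

context cring
begin

section \<open>Unit frames from points of a hyperplane\<close>

lemma vec_diff_closed:
  assumes "x \<in> vecs R d" "z \<in> vecs R d" "k < d"
  shows "vec_diff R d x z k \<in> carrier R"
  using assms vecs_closed unfolding vec_diff_def by auto

text \<open>An analogue of Steinitz exchange, with units in the role of nonzero determinants.
  Assumption \<open>vi\<close> puts the outgoing column in the kernel of the functional that is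
  constant on \<open>S\<close>. Assumption \<open>large\<close> is the bound
  \<open>|S| > |M| N^(d-2)\<close> multiplied by \<open>N^2\<close>, where \<open>N\<close> is the
  order of the ring.\<close>

lemma exists_unit_exchange:
  assumes fin: "finite (carrier R)" and d: "2 \<le> d"
    and M: "M \<subseteq> carrier R" and nonunits: "carrier R - Units R \<subseteq> M"
    and s: "s \<in> carrier R" and t: "t \<in> carrier R"
    and S: "S \<subseteq> vecs R d" "\<And>x. x \<in> S \<Longrightarrow> x 0 \<oplus> s \<otimes> x 1 = t" and z: "z \<in> vecs R d"
    and large: "card M * card (carrier R) ^ d < card S * (card (carrier R))\<^sup>2"
    and i: "i < d" and v: "\<And>j k. j < d \<Longrightarrow> k < d \<Longrightarrow> v j k \<in> carrier R"
    and vi: "v i 0 \<oplus> s \<otimes> v i 1 = \<zero>"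
    and unit: "det_cols R d v \<in> Units R"
  shows "\<exists>x\<in>S. det_cols R d (v(i := vec_diff R d x z)) \<in> Units R"
proof (rule ccontr)
  \<comment> \<open>Otherwise \<open>(x, c, b) \<mapsto> (x + c v\<^sub>i + b e\<^sub>0, L(x - z))\<close> would embed \<open>S \<times> R \<times> R\<close> into
    \<open>R\<^sup>d \<times> M\<close>, where \<open>L\<close> is the determinant as a function of column \<open>i\<close>.\<close>
  assume contra: "\<not> ?thesis"
  let ?L = "\<lambda>w. det_cols R d (v(i := w))"
  let ?h = "\<lambda>x c b. \<lambda>k\<in>{..<d}. x k \<oplus> (c \<otimes> v i k \<oplus> (if k = 0 then b else \<zero>))"
  let ?f = "\<lambda>(x, c, b). (?h x c b, ?L (vec_diff R d x z))"
  have d01: "0 < d" "1 < d" using d by auto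
  have cl: "x k \<in> carrier R" if "x \<in> S" "k < d" for x k using that S vecs_closed by blast
  have zc: "z k \<in> carrier R" if "k < d" for k using that z vecs_closed by blast
  have dc: "vec_diff R d x z k \<in> carrier R" if "x \<in> S" "k < d" for x k
    using that S z vec_diff_closed by blast
  have Lc: "?L w \<in> carrier R" if "\<And>k. k < d \<Longrightarrow> w k \<in> carrier R" for w
    using that v by (intro det_cols_closed) auto
  have LM: "?L (vec_diff R d x z) \<in> M" if "x \<in> S" for x
    using Lc[of "vec_diff R d x z"] dc that contra nonunits by blast
  have "inj_on ?f (S \<times> carrier R \<times> carrier R)"
  proof (rule inj_onI)
    fix p p' assume *: "p \<in> S \<times> carrier R \<times> carrier R" "p' \<in> S \<times> carrier R \<times> carrier R" "?f p = ?f p'"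
    obtain x c b where p: "p = (x, c, b)" by (cases p)
    obtain x' c' b' where p': "p' = (x', c', b')" by (cases p')
    have m: "x \<in> S" "x' \<in> S" "c \<in> carrier R" "c' \<in> carrier R" "b \<in> carrier R" "b' \<in> carrier R"
      using * unfolding p p' by auto
    have h: "?h x c b = ?h x' c' b'" and L: "?L (vec_diff R d x z) = ?L (vec_diff R d x' z)"
      using *(3) unfolding p p' by (simp_all only: case_prod_conv prod.inject)
    have hk: "x k \<oplus> (c \<otimes> v i k \<oplus> (if k = 0 then b else \<zero>)) =
        x' k \<oplus> (c' \<otimes> v i k \<oplus> (if k = 0 then b' else \<zero>))" if "k < d" for k
      using fun_cong[OF h, of k] that by simp
    \<comment> \<open>Applying the functional to the first component gives
      \<open>t \<oplus> b\<close>: \<open>x\<close> contributes \<open>t\<close>, and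
      \<open>v i\<close> contributes zero. This recovers \<open>b\<close>.\<close>
    have functional: "(x 0 \<oplus> (c \<otimes> v i 0 \<oplus> b)) \<oplus> s \<otimes> (x 1 \<oplus> (c \<otimes> v i 1 \<oplus> \<zero>)) = t \<oplus> b"
      if "x \<in> S" "c \<in> carrier R" "b \<in> carrier R" for x c b
    proof -
      have "x 0 \<in> carrier R" "x 1 \<in> carrier R" "v i 0 \<in> carrier R" "v i 1 \<in> carrier R"
        using that cl v i d01 by auto
      then have "(x 0 \<oplus> (c \<otimes> v i 0 \<oplus> b)) \<oplus> s \<otimes> (x 1 \<oplus> (c \<otimes> v i 1 \<oplus> \<zero>)) =
          (x 0 \<oplus> s \<otimes> x 1) \<oplus> c \<otimes> (v i 0 \<oplus> s \<otimes> v i 1) \<oplus> b"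
        using that(2,3) s by algebra
      then show ?thesis using S(2)[OF that(1)] vi that(2,3) t by simp
    qed
    have "t \<oplus> b = t \<oplus> b'"
      using functional[OF m(1,3,5)] functional[OF m(2,4,6)] hk[OF d01(1)] hk[OF d01(2)] by simp
    then have b: "b = b'" using t m by simp
    have xk: "x k \<oplus> c \<otimes> v i k = x' k \<oplus> c' \<otimes> v i k" if "k < d" for k
    proof -
      have "x k \<in> carrier R" "x' k \<in> carrier R" "v i k \<in> carrier R"
        using that cl m v i by auto
      then show ?thesis using hk[OF that] m unfolding b
        by (cases "k = 0") (simp_all add: a_assoc[symmetric])
    qed
    \<comment> \<open>Once \<open>b\<close> is known, so is \<open>x + c v_i\<close>. Its
      \<open>L\<close>-value, after the shift by \<open>z\<close>, differs from the second component
      by \<open>c\<close> times the unit \<open>det_cols R d v\<close>, which recovers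
      \<open>c\<close> and then \<open>x\<close>.\<close>
    have Lx: "?L (\<lambda>k. (x k \<ominus> z k) \<oplus> c \<otimes> v i k) =
        ?L (vec_diff R d x z) \<oplus> c \<otimes> det_cols R d v" if "x \<in> S" "c \<in> carrier R" for x c
    proof -
      have "?L (\<lambda>k. (x k \<ominus> z k) \<oplus> c \<otimes> v i k) = ?L (\<lambda>k. vec_diff R d x z k \<oplus> c \<otimes> v i k)"
        using v i that cl zc by (intro det_cols_cong) (auto simp: vec_diff_def)
      also have "\<dots> = ?L (vec_diff R d x z) \<oplus> ?L (\<lambda>k. c \<otimes> v i k)"
        using v i that dc by (intro det_cols_add) auto
      also have "?L (\<lambda>k. c \<otimes> v i k) = c \<otimes> ?L (v i)"
        using v i that by (intro det_cols_smult) auto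
      also have "v(i := v i) = v" by simp
      finally show ?thesis .
    qed
    have "?L (\<lambda>k. (x k \<ominus> z k) \<oplus> c \<otimes> v i k) = ?L (\<lambda>k. (x' k \<ominus> z k) \<oplus> c' \<otimes> v i k)"
    proof (rule det_cols_cong)
      have "(x k \<ominus> z k) \<oplus> c \<otimes> v i k = (x' k \<ominus> z k) \<oplus> c' \<otimes> v i k" if "k < d" for k
      proof -
        have cs: "x k \<in> carrier R" "x' k \<in> carrier R" "z k \<in> carrier R" "v i k \<in> carrier R"
          using that cl m v i zc by auto
        have "(x k \<ominus> z k) \<oplus> c \<otimes> v i k = (x k \<oplus> c \<otimes> v i k) \<ominus> z k"
          using cs m(3) by algebra
        also have "\<dots> = (x' k \<ominus> z k) \<oplus> c' \<otimes> v i k"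
          unfolding xk[OF that] using cs m(4) by algebra
        finally show ?thesis .
      qed
      then show "(v(i := \<lambda>k. (x k \<ominus> z k) \<oplus> c \<otimes> v i k)) j k =
          (v(i := \<lambda>k. (x' k \<ominus> z k) \<oplus> c' \<otimes> v i k)) j k" if "j < d" "k < d" for j k
        using that by simp
      show "(v(i := \<lambda>k. (x' k \<ominus> z k) \<oplus> c' \<otimes> v i k)) j k \<in> carrier R" if "j < d" "k < d" for j k
        using that cl m v i zc by auto
    qed
    then have "?L (vec_diff R d x z) \<oplus> c \<otimes> det_cols R d v =
        ?L (vec_diff R d x z) \<oplus> c' \<otimes> det_cols R d v"
      unfolding Lx[OF m(1,3)] Lx[OF m(2,4)] L .
    then have "c \<otimes> det_cols R d v = c' \<otimes> det_cols R d v"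
      using m(3,4) Lc[OF dc[OF m(1)]] Units_closed[OF unit] by simp
    then have "det_cols R d v \<otimes> c = det_cols R d v \<otimes> c'"
      using m(3,4) Units_closed[OF unit] by (simp add: m_comm)
    then have c: "c = c'" using unit m(3,4) by (simp only: Units_l_cancel)
    have "x k = x' k" if "k < d" for k
    proof -
      have "x k \<in> carrier R" "x' k \<in> carrier R" "v i k \<in> carrier R"
        using that cl m v i by auto
      then show ?thesis using xk[OF that] m unfolding c by simp
    qed
    then have "x = x'" using m S by (intro vecs_eqI[of x d x']) auto
    then show "p = p'" unfolding p p' using b c by simp
  qed
  moreover have "?f ` (S \<times> carrier R \<times> carrier R) \<subseteq> vecs R d \<times> M"
  proof -
    have "?h x c b \<in> vecs R d" if "x \<in> S" "c \<in> carrier R" "b \<in> carrier R" for x c b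
      unfolding vecs_def using that cl v i by (intro restrict_PiE_iff[THEN iffD2]) auto
    then show ?thesis using LM by auto
  qed
  moreover have "finite (vecs R d \<times> M)"
    using finite_vecs[OF fin] finite_subset[OF M fin] by auto
  ultimately have "card (S \<times> carrier R \<times> carrier R) \<le> card (vecs R d \<times> M)"
    by (rule card_inj_on_le)
  then have "card S * (card (carrier R))\<^sup>2 \<le> card M * card (carrier R) ^ d"
    by (simp add: card_cartesian_product vecs_def card_PiE power2_eq_square mult.commute)
  then show False using large by simp
qed

text \<open>Starting from a basis adapted to the hyperplane, columns \<open>1\<close> to
  \<open>d - 1\<close> are exchanged one at a time for differences with points of \<open>S\<close>.
  Column 0 stays the first standard vector, so the resulting unit is exactly the cofactor that
  appears in \<open>det_cols_factor\<close>.\<close>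

lemma exists_unit_frame:
  assumes fin: "finite (carrier R)" and d: "2 \<le> d"
    and M: "M \<subseteq> carrier R" and nonunits: "carrier R - Units R \<subseteq> M"
    and s: "s \<in> carrier R" and t: "t \<in> carrier R"
    and S: "S \<subseteq> vecs R d" "\<And>x. x \<in> S \<Longrightarrow> x 0 \<oplus> s \<otimes> x 1 = t" and z: "z \<in> vecs R d"
    and large: "card M * card (carrier R) ^ d < card S * (card (carrier R))\<^sup>2"
  shows "\<exists>x. (\<forall>i. 0 < i \<and> i < d \<longrightarrow> x i \<in> S) \<and>
    det_cols R d ((\<lambda>i. vec_diff R d (x i) z)(0 := (\<lambda>k. if k = 0 then \<one> else \<zero>))) \<in> Units R"
proof -
  \<comment> \<open>The standard basis, except that \<open>b 1\<close> has the entry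
    \<open>\<ominus> s\<close> in row 0. Thus \<open>b 1\<close>, ..., \<open>b (d - 1)\<close> all
    lie in the kernel of \<open>y 0 \<oplus> s \<otimes> y 1\<close>, and the matrix is still
    unitriangular.\<close>
  define b :: "nat \<Rightarrow> nat \<Rightarrow> 'a"
    where "b = (\<lambda>i k. if i = k then \<one> else if i = 1 \<and> k = 0 then \<ominus> s else \<zero>)"
  have d01: "0 < d" "1 < d" using d by auto
  have bc: "b i k \<in> carrier R" for i k using s by (auto simp: b_def)
  let ?v = "\<lambda>m x i. if 0 < i \<and> i \<le> m then vec_diff R d (x i) z else b i"
  have frame: "\<exists>x. (\<forall>i. 0 < i \<and> i \<le> m \<longrightarrow> x i \<in> S) \<and> det_cols R d (?v m x) \<in> Units R"
    if "m < d" for m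
    using that
  proof (induction m)
    case 0
    have "det_cols R d b = \<one>"
      using bc by (intro det_cols_unitriangular) (auto simp: b_def)
    moreover have "?v 0 undefined = b" by (auto simp: fun_eq_iff)
    ultimately have "det_cols R d (?v 0 undefined) \<in> Units R" by simp
    then show ?case by auto
  next
    case (Suc m)
    then obtain x where x: "\<And>i. 0 < i \<Longrightarrow> i \<le> m \<Longrightarrow> x i \<in> S" "det_cols R d (?v m x) \<in> Units R"
      by auto
    have "\<exists>y\<in>S. det_cols R d ((?v m x)(Suc m := vec_diff R d y z)) \<in> Units R"
    proof (rule exists_unit_exchange[OF fin d M nonunits s t S z large \<open>Suc m < d\<close> _ _ x(2)])
      \<comment> \<open>Column \<open>Suc m\<close> has not been exchanged yet: it is still
        \<open>b (Suc m)\<close>, which provides the kernel condition below.\<close>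
      show "?v m x j k \<in> carrier R" if "j < d" "k < d" for j k
        using that bc x(1) S z by (auto intro!: vec_diff_closed)
      show "?v m x (Suc m) 0 \<oplus> s \<otimes> ?v m x (Suc m) 1 = \<zero>"
        using s by (auto simp: b_def l_neg)
    qed
    then obtain y where y: "y \<in> S" "det_cols R d ((?v m x)(Suc m := vec_diff R d y z)) \<in> Units R"
      by blast
    have "(?v m x)(Suc m := vec_diff R d y z) = ?v (Suc m) (x(Suc m := y))"
      by (auto simp: fun_eq_iff)
    then have "det_cols R d (?v (Suc m) (x(Suc m := y))) \<in> Units R" using y(2) by simp
    moreover have "\<forall>i. 0 < i \<and> i \<le> Suc m \<longrightarrow> (x(Suc m := y)) i \<in> S"
      using x(1) y(1) by auto
    ultimately show ?case by blast
  qed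
  have "d - 1 < d" using d01 by simp
  from frame[OF this] obtain x where
    "\<forall>i. 0 < i \<and> i \<le> d - 1 \<longrightarrow> x i \<in> S" and unit: "det_cols R d (?v (d - 1) x) \<in> Units R"
    by (elim exE conjE)
  then have x: "x i \<in> S" if "0 < i" "i < d" for i using that by auto
  have "det_cols R d (?v (d - 1) x) =
      det_cols R d ((\<lambda>i. vec_diff R d (x i) z)(0 := (\<lambda>k. if k = 0 then \<one> else \<zero>)))"
    using x S z
    by (intro det_cols_cong) (auto simp: b_def intro!: vec_diff_closed)
  then have "det_cols R d ((\<lambda>i. vec_diff R d (x i) z)(0 := (\<lambda>k. if k = 0 then \<one> else \<zero>))) \<in> Units R"
    using unit by (simp only:)
  then show ?thesis using x by blast
qed

text \<open>Column 0 is split as \<open>?a\<close> times the first standard vector plus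
  \<open>?w\<close>, where \<open>?w\<close> lies in the kernel of the functional. With
  \<open>?w\<close> in place, every column is in that kernel, so row 0 is \<open>\<ominus> s\<close>
  times row 1 and the second determinant vanishes.\<close>

lemma det_cols_factor:
  assumes d: "2 \<le> d" and s: "s \<in> carrier R"
    and v: "\<And>j k. j < d \<Longrightarrow> k < d \<Longrightarrow> v j k \<in> carrier R"
    and ker: "\<And>j. 0 < j \<Longrightarrow> j < d \<Longrightarrow> v j 0 \<oplus> s \<otimes> v j 1 = \<zero>"
  shows "det_cols R d v = (v 0 0 \<oplus> s \<otimes> v 0 1) \<otimes>
    det_cols R d (v(0 := (\<lambda>k. if k = 0 then \<one> else \<zero>)))"
proof -
  let ?e = "\<lambda>k::nat. if k = 0 then \<one> else \<zero>"
  let ?a = "v 0 0 \<oplus> s \<otimes> v 0 1"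
  let ?w = "\<lambda>k. if k = 0 then \<ominus> s \<otimes> v 0 1 else v 0 k"
  have d01: "0 < d" "1 < d" using d by auto
  have a: "?a \<in> carrier R" using v s d01 by auto
  have "det_cols R d v = det_cols R d (v(0 := \<lambda>k. ?a \<otimes> ?e k \<oplus> ?w k))"
  proof (rule det_cols_cong)
    have "v 0 0 \<in> carrier R" "v 0 1 \<in> carrier R" using v d01 by auto
    then have "v 0 0 = ?a \<otimes> \<one> \<oplus> \<ominus> s \<otimes> v 0 1" using s by algebra
    then show "v j k = (v(0 := \<lambda>k. ?a \<otimes> ?e k \<oplus> ?w k)) j k" if "j < d" "k < d" for j k
      using that v a by auto
    show "(v(0 := \<lambda>k. ?a \<otimes> ?e k \<oplus> ?w k)) j k \<in> carrier R" if "j < d" "k < d" for j k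
      using that v a s d01 by auto
  qed
  also have "\<dots> = det_cols R d (v(0 := \<lambda>k. ?a \<otimes> ?e k)) \<oplus> det_cols R d (v(0 := ?w))"
    using v a s d01 by (intro det_cols_add) auto
  also have "det_cols R d (v(0 := \<lambda>k. ?a \<otimes> ?e k)) = ?a \<otimes> det_cols R d (v(0 := ?e))"
    using v a d01 by (intro det_cols_smult) auto
  also have "det_cols R d (v(0 := ?w)) = \<zero>"
  proof (rule det_cols_eq_zero_if_proportional_rows[where k = 0 and l = 1 and s = "\<ominus> s"])
    show "(v(0 := ?w)) i 0 = \<ominus> s \<otimes> (v(0 := ?w)) i 1" if "i < d" for i
    proof (cases "i = 0")
      case False
      have "v i 0 \<in> carrier R" "v i 1 \<in> carrier R" using v d01 that by auto
      then show ?thesis using ker[of i] False that s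
        by (simp add: l_minus) (metis add.inv_equality m_closed s)
    qed auto
  qed (use v s d01 in auto)
  also have "?a \<otimes> det_cols R d (v(0 := ?e)) \<oplus> \<zero> = ?a \<otimes> det_cols R d (v(0 := ?e))"
    using a v by (intro r_zero m_closed det_cols_closed) auto
  finally show ?thesis .
qed

section \<open>Volumes pinned at a point of a popular hyperplane\<close>

lemma pinned_volumes_subset:
  assumes "E \<subseteq> vecs R d" "z \<in> E"
  shows "pinned_volumes R d E z \<subseteq> carrier R"
  unfolding pinned_volumes_def using assms
  by (auto intro!: det_cols_closed vec_diff_closed)

text \<open>This is the estimate for a single ring: a proportion of at least
  \<open>|E| / (|E| + |M| N^(d-1))\<close> of all ring elements occur as volumes pinned at
  \<open>z\<close>. The same slope \<open>s\<close> serves for the image bound and for the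
  hyperplane.\<close>

lemma pinned_volumes_lower_bound:
  assumes fin: "finite (carrier R)" and d: "2 \<le> d" and E: "E \<subseteq> vecs R d"
    and M: "M \<subseteq> carrier R" and nonunits: "carrier R - Units R \<subseteq> M"
    and large: "card M * card (carrier R) ^ (d - 1) < card E"
  shows "\<exists>z\<in>E. card (carrier R) * card E \<le>
    card (pinned_volumes R d E z) * (card E + card M * card (carrier R) ^ (d - 1))"
proof -
  let ?N = "card (carrier R)"
  let ?B = "card E + card M * ?N ^ (d - 1)"
  have finE: "finite E" using finite_subset[OF E finite_vecs[OF fin]] .
  have N: "0 < ?N" using fin zero_closed by (auto simp: card_gt_0_iff)
  have d01: "0 < d" "1 < d" using d by auto
  have cl: "y k \<in> carrier R" if "y \<in> E" "k < d" for y k using that E vecs_closed by blast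
  have "E \<noteq> {}" using large by auto
  then obtain s where s: "s \<in> carrier R"
    and img: "?N * card E \<le> card ((\<lambda>y. y 0 \<oplus> s \<otimes> y 1) ` E) * ?B"
    using exists_equidistributing_slope[OF fin d E _ M nonunits] by blast
  let ?a = "\<lambda>y. y 0 \<oplus> s \<otimes> y 1"
  have ac: "?a y \<in> carrier R" if "y \<in> E" for y using that cl d01 s by auto
  obtain t where t: "t \<in> carrier R" "card E \<le> ?N * card {y \<in> E. ?a y = t}"
    using exists_large_fibre[OF finE fin, of ?a] ac zero_closed by blast
  let ?S = "{y \<in> E. ?a y = t}"
  have "card M * ?N ^ d = ?N * (card M * ?N ^ (d - 1))"
    using d by (cases d) auto
  also have "\<dots> < ?N * card E" using large N by simp
  also have "\<dots> \<le> card ?S * ?N\<^sup>2" using mult_left_mono[OF t(2), of ?N] by (simp add: power2_eq_square mult_ac)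
  finally have big: "card M * ?N ^ d < card ?S * ?N\<^sup>2" .
  \<comment> \<open>Any point of the popular fibre can be the pin: its functional value is
    \<open>t\<close>, so differences of fibre points with it lie in the kernel.\<close>
  then have "?S \<noteq> {}" by (metis card.empty mult_0 not_less_zero)
  then obtain z where z: "z \<in> ?S" by blast
  have "\<exists>x. (\<forall>i. 0 < i \<and> i < d \<longrightarrow> x i \<in> ?S) \<and>
    det_cols R d ((\<lambda>i. vec_diff R d (x i) z)(0 := (\<lambda>k. if k = 0 then \<one> else \<zero>))) \<in> Units R"
    using E z by (intro exists_unit_frame[OF fin d M nonunits s t(1) _ _ _ big]) auto
  then obtain x where x: "\<And>i. 0 < i \<Longrightarrow> i < d \<Longrightarrow> x i \<in> ?S"
    and u: "det_cols R d ((\<lambda>i. vec_diff R d (x i) z)(0 := (\<lambda>k. if k = 0 then \<one> else \<zero>))) \<in> Units R"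
      (is "?u \<in> _") by blast
  have a_diff: "vec_diff R d y z 0 \<oplus> s \<otimes> vec_diff R d y z 1 = ?a y \<ominus> t" if "y \<in> E" for y
  proof -
    have c: "y 0 \<in> carrier R" "y 1 \<in> carrier R" "z 0 \<in> carrier R" "z 1 \<in> carrier R"
      using that z cl d01 by auto
    have "(y 0 \<ominus> z 0) \<oplus> s \<otimes> (y 1 \<ominus> z 1) = ?a y \<ominus> ?a z"
      using c s by algebra
    then show ?thesis using z d01 by (simp add: vec_diff_def)
  qed
  \<comment> \<open>Only the point in column 0 varies; the frame in the other columns is fixed, so
    each volume is \<open>?a y \<ominus> t\<close> times the same unit.\<close>
  have sub: "(\<lambda>c. (c \<ominus> t) \<otimes> ?u) ` ?a ` E \<subseteq> pinned_volumes R d E z"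
  proof clarify
    fix y assume y: "y \<in> E"
    \<comment> \<open>The frame leaves \<open>x 0\<close> unspecified, since its column 0 is
      overwritten; here that slot receives \<open>y\<close>.\<close>
    let ?x = "x(0 := y)"
    have xE: "?x i \<in> E" if "i < d" for i using that y x[of i] by (cases "i = 0") auto
    let ?v = "\<lambda>i. vec_diff R d (?x i) z"
    have "det_cols R d ?v = (?v 0 0 \<oplus> s \<otimes> ?v 0 1) \<otimes>
      det_cols R d (?v(0 := (\<lambda>k. if k = 0 then \<one> else \<zero>)))"
    proof (rule det_cols_factor[OF d s])
      show "?v j k \<in> carrier R" if "j < d" "k < d" for j k
        using that xE[of j] E z by (intro vec_diff_closed) auto
      show "?v j 0 \<oplus> s \<otimes> ?v j 1 = \<zero>" if "0 < j" "j < d" for j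
        using a_diff[of "x j"] x[OF that] that t(1) by (simp add: minus_eq r_neg)
    qed
    also have "?v(0 := (\<lambda>k. if k = 0 then \<one> else \<zero>)) =
        (\<lambda>i. vec_diff R d (x i) z)(0 := (\<lambda>k. if k = 0 then \<one> else \<zero>))"
      by (auto simp: fun_eq_iff)
    also have "?v 0 0 \<oplus> s \<otimes> ?v 0 1 = ?a y \<ominus> t" using a_diff[OF y] by simp
    finally have "(?a y \<ominus> t) \<otimes> ?u = det_cols R d ?v" ..
    then show "(?a y \<ominus> t) \<otimes> ?u \<in> pinned_volumes R d E z"
      unfolding pinned_volumes_def using xE by blast
  qed
  have finP: "finite (pinned_volumes R d E z)"
    using pinned_volumes_subset[OF E] z finite_subset[OF _ fin] by blast
  have inj: "inj_on (\<lambda>c. (c \<ominus> t) \<otimes> ?u) (?a ` E)"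
  proof (rule inj_onI)
    fix c c' assume "c \<in> ?a ` E" "c' \<in> ?a ` E" and eq: "(c \<ominus> t) \<otimes> ?u = (c' \<ominus> t) \<otimes> ?u"
    then have c: "c \<in> carrier R" "c' \<in> carrier R" using ac by auto
    then have "?u \<otimes> (c \<ominus> t) = ?u \<otimes> (c' \<ominus> t)" using eq Units_closed[OF u] t(1) by (simp add: m_comm)
    then have "c \<ominus> t = c' \<ominus> t" using c u t(1) by (simp only: Units_l_cancel minus_closed)
    then show "c = c'" using c t(1) by (simp add: minus_eq)
  qed
  have "card (?a ` E) \<le> card (pinned_volumes R d E z)"
    by (rule card_inj_on_le[OF inj sub finP])
  then have "?N * card E \<le> card (pinned_volumes R d E z) * ?B"
    by (intro order_trans[OF img] mult_le_mono1)
  then show ?thesis using z by blast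
qed

end

section \<open>Finite valuation rings\<close>

lemma finite_valuation_ring_max_ideal:
  assumes "finite_valuation_ring R"
  shows "maximalideal (the_max_ideal R) R"
  using assms theI'[of "\<lambda>M. maximalideal M R"]
  unfolding finite_valuation_ring_def the_max_ideal_def by blast

text \<open>The principal ideal of a nonunit is proper. The chain condition makes it comparable with
  the maximal ideal, and maximality excludes that it is strictly larger.\<close>

lemma finite_valuation_ring_nonunits:
  fixes R (structure)
  assumes "finite_valuation_ring R"
  shows "carrier R - Units R \<subseteq> the_max_ideal R"
proof
  fix x assume x: "x \<in> carrier R - Units R"
  interpret cring R using assms by (simp add: finite_valuation_ring_def)
  let ?M = "the_max_ideal R"
  let ?I = "PIdl x"
  have M: "maximalideal ?M R" using finite_valuation_ring_max_ideal[OF assms] .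
  have I: "ideal ?I R" using x by (intro cgenideal_ideal) auto
  have xI: "x \<in> ?I" using x by (intro cgenideal_self) auto
  have "?I \<noteq> carrier R"
  proof
    assume "?I = carrier R"
    then have "\<one> \<in> ?I" by simp
    then obtain y where "y \<in> carrier R" "\<one> = y \<otimes> x" unfolding cgenideal_def by auto
    then show False using x by (auto simp: Units_def m_comm)
  qed
  moreover have "?I \<subseteq> ?M \<or> ?M \<subseteq> ?I"
    using assms I maximalideal.axioms(1)[OF M] unfolding finite_valuation_ring_def by blast
  ultimately have "?I \<subseteq> ?M"
    using maximalideal.I_maximal[OF M I] additive_subgroup.a_subset[OF ideal.axioms(1)[OF I]] by blast
  then show "x \<in> ?M" using xI by blast
qed

text \<open>Lagrange's theorem for the additive group: the elements of the residue field are the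
  cosets of the maximal ideal.\<close>

lemma card_residue_field:
  fixes R (structure)
  assumes "finite_valuation_ring R"
  shows "card (carrier (residue_field R)) * card (the_max_ideal R) = card (carrier R)"
proof -
  interpret cring R using assms by (simp add: finite_valuation_ring_def)
  interpret M: maximalideal "the_max_ideal R" R
    using finite_valuation_ring_max_ideal[OF assms] .
  have "finite (carrier R)" using assms by (simp add: finite_valuation_ring_def)
  then have "card (the_max_ideal R) * card (a_rcosets (the_max_ideal R)) = order (add_monoid R)"
    using a_lagrange[of "the_max_ideal R"] M.additive_subgroup_axioms by (simp add: mult.commute order_def)
  then show ?thesis
    by (simp add: residue_field_def FactRing_def order_def mult.commute)
qed

text \<open>Turns the counting bound into an error term: the missing proportion is at most
  \<open>A / (B + A)\<close>, hence at most \<open>A / B\<close>, which is the ratio assumed to tend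
  to 0.\<close>

lemma relative_deficiency_le:
  fixes A B N P :: real
  assumes "0 < B" "0 \<le> A" "0 < N" "N * B \<le> P * (B + A)"
  shows "1 - P / N \<le> A / B"
proof -
  have "B / (B + A) \<le> P / N" using assms by (simp add: field_simps)
  moreover have "1 - B / (B + A) = A / (B + A)" using assms by (simp add: field_simps)
  moreover have "A / (B + A) \<le> A / B" using assms by (intro divide_left_mono) auto
  ultimately show ?thesis by linarith
qed

section \<open>Asymptotics along a sequence of rings\<close>

theorem theorem1p4:
  fixes R :: "nat \<Rightarrow> 'a ring" and E :: "nat \<Rightarrow> (nat \<Rightarrow> 'a) set"
    and q :: "nat \<Rightarrow> nat" and r d :: nat
  assumes "d \<ge> 2"
    and "\<And>n. finite_valuation_ring (R n)"
    and "\<And>n. card (carrier (residue_field (R n))) = q n"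
    and "\<And>n. primepow (q n)" and "\<And>n. odd (q n)"
    and "\<And>n. card (carrier (R n)) = q n ^ r"
    and "\<And>n. E n \<subseteq> vecs (R n) d"
    and "filterlim q at_top sequentially"
    and "(\<lambda>n. real (q n ^ (r - 1) * q n ^ (r * (d - 1)))) \<in> o(\<lambda>n. real (card (E n)))"
  shows "\<exists>(z :: nat \<Rightarrow> nat \<Rightarrow> 'a) (\<epsilon> :: nat \<Rightarrow> real). \<epsilon> \<in> o(\<lambda>_. 1) \<and>
    (\<forall>\<^sub>F n in sequentially. z n \<in> E n \<and>
       real (card (pinned_volumes (R n) d (E n) (z n))) = (1 - \<epsilon> n) * real (q n ^ r))"
proof -
  define A where "A = (\<lambda>n. real (q n ^ (r - 1) * q n ^ (r * (d - 1))))"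
  define B where "B = (\<lambda>n. real (card (E n)))"
  let ?P = "\<lambda>n z. pinned_volumes (R n) d (E n) z"
  have q: "q n > 1" for n using assms(4) primepow_gt_Suc_0 by fastforce
  have cardM: "card (the_max_ideal (R n)) = q n ^ (r - 1)" for n
  proof -
    have eq: "q n * card (the_max_ideal (R n)) = q n ^ r"
      using card_residue_field[OF assms(2)] assms(3,6) by metis
    \<comment> \<open>For \<open>r = 0\<close> the product on the left of \<open>eq\<close> would be
      1 although \<open>q n > 1\<close>. So the natural-number subtraction \<open>r - 1\<close> does
      not truncate.\<close>
    have "r \<noteq> 0" using eq q[of n] by (cases "r = 0") auto
    then have "q n * card (the_max_ideal (R n)) = q n * q n ^ (r - 1)"
      unfolding eq by (cases r) auto
    then show ?thesis using q[of n] by simp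
  qed
  have Apos: "A n > 0" for n using q[of n] by (simp add: A_def)
  have lim: "(\<lambda>n. A n / B n) \<longlonglongrightarrow> 0"
    using assms(9) unfolding A_def B_def by (rule smalloD_tendsto)
  have ex: "\<exists>z\<in>E n. real (q n ^ r) * B n \<le> real (card (?P n z)) * (B n + A n)"
    if "A n < B n" for n
  proof -
    interpret cring "R n" using assms(2)[of n] by (simp add: finite_valuation_ring_def)
    have fin: "finite (carrier (R n))" using assms(2)[of n] by (simp add: finite_valuation_ring_def)
    have sub: "the_max_ideal (R n) \<subseteq> carrier (R n)"
      using finite_valuation_ring_max_ideal[OF assms(2)]
      by (meson additive_subgroup.a_subset ideal.axioms(1) maximalideal.axioms(1))
    have A: "card (the_max_ideal (R n)) * card (carrier (R n)) ^ (d - 1) =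
        q n ^ (r - 1) * q n ^ (r * (d - 1))"
      by (simp only: cardM assms(6) power_mult)
    have "q n ^ (r - 1) * q n ^ (r * (d - 1)) < card (E n)"
      using that unfolding A_def B_def by (simp only: of_nat_less_iff)
    then obtain z where z: "z \<in> E n" and le: "q n ^ r * card (E n) \<le>
        card (?P n z) * (card (E n) + q n ^ (r - 1) * q n ^ (r * (d - 1)))"
      using pinned_volumes_lower_bound[OF fin assms(1) assms(7) sub
          finite_valuation_ring_nonunits[OF assms(2)], unfolded A] assms(6)[of n] by auto
    have "real (q n ^ r) * B n \<le> real (card (?P n z)) * (B n + A n)"
      using le unfolding A_def B_def by (simp only: of_nat_le_iff flip: of_nat_mult of_nat_add)
    then show ?thesis using z by blast
  qed
  \<comment> \<open>The implication lets the pins be chosen for all \<open>n\<close> at once; where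
    \<open>A n < B n\<close> fails, which happens only finitely often, \<open>z n\<close> is
    arbitrary.\<close>
  have "\<forall>n. \<exists>z. A n < B n \<longrightarrow> z \<in> E n \<and>
      real (q n ^ r) * B n \<le> real (card (?P n z)) * (B n + A n)"
    using ex by blast
  from choice[OF this] obtain z where z0: "\<forall>n. A n < B n \<longrightarrow> z n \<in> E n \<and>
      real (q n ^ r) * B n \<le> real (card (?P n (z n))) * (B n + A n)"
    by (elim exE)
  \<comment> \<open>Defined as the exact relative deficiency, so that the required equation holds by
    construction and only the decay of \<open>\<epsilon>\<close> remains to be shown.\<close>
  define \<epsilon> where "\<epsilon> = (\<lambda>n. 1 - real (card (?P n (z n))) / real (q n ^ r))"
  have z: "z n \<in> E n \<and> real (q n ^ r) * B n \<le> real (card (?P n (z n))) * (B n + A n)"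
    if "A n < B n" for n
    using z0 that by blast
  have bound: "norm (\<epsilon> n) \<le> A n / B n" if AB: "A n < B n" for n
  proof -
    interpret cring "R n" using assms(2)[of n] by (simp add: finite_valuation_ring_def)
    have fin: "finite (carrier (R n))" using assms(2)[of n] by (simp add: finite_valuation_ring_def)
    have "card (?P n (z n)) \<le> q n ^ r"
      using card_mono[OF fin pinned_volumes_subset[OF assms(7)]] z[OF AB] assms(6) by metis
    then have "real (card (?P n (z n))) \<le> real (q n ^ r)" by (simp only: of_nat_le_iff)
    \<comment> \<open>The volumes are ring elements, so the deficiency is nonnegative and an upper
      bound on it controls its norm.\<close>
    then have "0 \<le> \<epsilon> n" using q[of n] by (simp add: \<epsilon>_def)
    moreover have "\<epsilon> n \<le> A n / B n"
      unfolding \<epsilon>_def using z[OF AB] Apos[of n] AB q[of n]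
      by (intro relative_deficiency_le) auto
    ultimately show ?thesis by simp
  qed
  \<comment> \<open>Any constant below 1 would do: together with \<open>A n > 0\<close> it makes the
    inequality \<open>A n < B n\<close> strict.\<close>
  have "\<forall>\<^sub>F n in sequentially. norm (A n) \<le> (1/2) * norm (B n)"
    using landau_o.smallD[OF assms(9), of "1/2"] unfolding A_def B_def by simp
  then have ev: "\<forall>\<^sub>F n in sequentially. A n < B n"
  proof eventually_elim
    case (elim n)
    then show ?case using Apos[of n] by (simp add: B_def)
  qed
  have "\<epsilon> \<longlonglongrightarrow> 0"
  proof (rule tendsto_0_le[OF lim, where K = 1])
    show "\<forall>\<^sub>F n in sequentially. norm (\<epsilon> n) \<le> norm (A n / B n) * 1"
      using ev
    proof eventually_elim
      case (elim n)
      show ?case using order_trans[OF bound[OF elim] abs_ge_self] by simp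
    qed
  qed
  then have "\<epsilon> \<in> o(\<lambda>_. 1)" by (intro smalloI_tendsto) auto
  moreover have "\<forall>\<^sub>F n in sequentially. z n \<in> E n \<and>
      real (card (?P n (z n))) = (1 - \<epsilon> n) * real (q n ^ r)"
    using ev
  proof eventually_elim
    case (elim n)
    have "real (q n ^ r) \<noteq> 0" using q[of n] by simp
    then show ?case using z[OF elim] by (simp add: \<epsilon>_def)
  qed
  ultimately show ?thesis by blast
qed

end
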